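(* For every integer $n\ge 0$, $$p(n)=\frac{1}{n!}\sum_{k=0}^{n}(-1)^{k}\, k!\, B_{n,k}(\lambda_{1},\lambda_{2},\ldots,\lambda_{n-k+1}),$$ where $p(n)$ is the number of partitions of $n$, $B_{n,k}$ is the $(n,k)$th partial Bell polynomial, and for each integer $m\ge 1$ $$\lambda_{m}=\begin{cases}(-1)^{\frac{1+\sqrt{1+24m}}{6}}\, m! & \text{if } \frac{1+\sqrt{1+24m}}{6}\in \mathbb{Z},\\ (-1)^{\frac{1-\sqrt{1+24m}}{6}}\, m! & \text{if } \frac{1-\sqrt{1+24m}}{6}\in \mathbb{Z},\\ 0 & \text{otherwise.}\end{cases}$$
   Context: The partition function $p(n)$ is the number of ways of writing the integer $n$ as a sum of positive integers, where the order of summands is not considered significant (with $p(0)=1$); equivalently $\sum_{n\ge 0}p(n)q^n=\prod_{j=1}^{\infty}\frac{1}{1-q^j}$. For integers $n,k\ge 0$, the $(n,k)$th partial Bell polynomial in the variables $x_1,\ldots,x_{n-k+1}$ is $$B_{n,k}(x_1,x_2,\ldots,x_{n-k+1})=\sum \frac{n!}{\prod_{i=1}^{n-k+1}\ell_i!}\prod_{i=1}^{n-k+1}\Bigl(\frac{x_i}{i!}\Bigr)^{\ell_i},$$ where the sum is over all sequences of nonnegative integers $\ell_1,\ell_2,\ldots$ with $\sum_{i} i\,\ell_i=n$ and $\sum_{i}\ell_i=k$ (these constraints force $\ell_i=0$ for $i>n-k+1$). In particular $B_{0,0}=1$ and $B_{n,0}=0$ for $n\ge 1$. *)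

theory Defs
  imports Complex_Main "HOL-Library.Multiset"
begin

definition partition_number :: "nat \<Rightarrow> nat" where
  "partition_number n = card {M :: nat multiset. 0 \<notin># M \<and> sum_mset M = n}"

text \<open>
  A sequence of multiplicities indexed by the positive integers is represented by a function
  on \<^typ>\<open>nat\<close> that vanishes at 0. The two constraints presuppose finite support, which
  has to be stated because \<^const>\<open>sum\<close> is 0 on infinite sets.
\<close>

definition bell_indices :: "nat \<Rightarrow> nat \<Rightarrow> (nat \<Rightarrow> nat) set" where
  "bell_indices n k =
     {l. l 0 = 0 \<and> finite {i. l i \<noteq> 0} \<and>
         (\<Sum>i | l i \<noteq> 0. i * l i) = n \<and> (\<Sum>i | l i \<noteq> 0. l i) = k}"

text \<open>
  The polynomial is given by its values at a sequence, of which only the entries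
  1, ..., \<open>n - k + 1\<close> matter. The truncated subtraction is harmless: for \<open>k > n\<close> the outer
  sum is empty.
\<close>

definition partial_bell :: "nat \<Rightarrow> nat \<Rightarrow> (nat \<Rightarrow> real) \<Rightarrow> real" where
  "partial_bell n k x =
     (\<Sum>l\<in>bell_indices n k.
        fact n / (\<Prod>i=1..n - k + 1. fact (l i)) *
        (\<Prod>i=1..n - k + 1. (x i / fact i) ^ l i))"

text \<open>
  The exponents are real numbers known to be integers in the respective case, possibly negative;
  \<^const>\<open>floor\<close> only converts them to type \<^typ>\<open>int\<close>. The value at 0 is never used.
\<close>

definition pent_lambda :: "nat \<Rightarrow> real" where
  "pent_lambda m =
     (if (1 + sqrt (1 + 24 * real m)) / 6 \<in> \<int>
      then (-1) powi \<lfloor>(1 + sqrt (1 + 24 * real m)) / 6\<rfloor> * fact m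
      else if (1 - sqrt (1 + 24 * real m)) / 6 \<in> \<int>
      then (-1) powi \<lfloor>(1 - sqrt (1 + 24 * real m)) / 6\<rfloor> * fact m
      else 0)"

text \<open>Neither the cardinality nor the outer sum above degenerates: both range over finite sets.\<close>

lemma finite_partitions: "finite {M :: nat multiset. 0 \<notin># M \<and> sum_mset M = n}"
proof (rule finite_subset)
  show "{M :: nat multiset. 0 \<notin># M \<and> sum_mset M = n} \<subseteq>
          mset ` {xs. set xs \<subseteq> {..n} \<and> length xs \<le> n}"
  proof
    fix M :: "nat multiset"
    assume "M \<in> {M. 0 \<notin># M \<and> sum_mset M = n}"
    then have M: "0 \<notin># M" "sum_mset M = n" by auto
    obtain xs where xs: "mset xs = M" using ex_mset by blast
    have "size M \<le> sum_mset M" using M(1)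
      by (induction M) auto
    moreover have "x \<le> sum_mset M" if "x \<in># M" for x
      using that by (metis le_add1 multi_member_split sum_mset.add_mset)
    ultimately have "set xs \<subseteq> {..n} \<and> length xs \<le> n"
      using xs M by (auto simp flip: set_mset_mset size_mset)
    with xs show "M \<in> mset ` {xs. set xs \<subseteq> {..n} \<and> length xs \<le> n}" by blast
  qed
  show "finite (mset ` {xs. set xs \<subseteq> {..n} \<and> length xs \<le> n})"
    by (intro finite_imageI finite_lists_length_le) simp
qed

lemma bell_indices_support:
  assumes "l \<in> bell_indices n k" "l i \<noteq> 0"
  shows "i \<in> {1..n - k + 1}"
proof -
  let ?S = "{i. l i \<noteq> 0}"
  have l: "l 0 = 0" "finite ?S" "(\<Sum>i\<in>?S. i * l i) = n" "(\<Sum>i\<in>?S. l i) = k"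
    using assms(1) by (auto simp: bell_indices_def)
  have pos: "1 \<le> j" if "j \<in> ?S" for j
    using that l(1) by (cases j) auto
  have "(\<Sum>j\<in>?S. (j - 1) * l j) + k = (\<Sum>j\<in>?S. (j - 1) * l j + l j)"
    by (simp only: sum.distrib l(4))
  also have "\<dots> = n"
    unfolding l(3)[symmetric] by (rule sum.cong) (use pos in \<open>auto simp: algebra_simps\<close>)
  finally have eq: "(\<Sum>j\<in>?S. (j - 1) * l j) + k = n" .
  have "(i - 1) * l i \<le> (\<Sum>j\<in>?S. (j - 1) * l j)"
    by (rule member_le_sum) (use assms l(2) in auto)
  moreover have "i - 1 \<le> (i - 1) * l i" using assms(2) by simp
  ultimately have "i - 1 \<le> n - k" using eq by linarith
  then show ?thesis using pos[of i] assms(2) by simp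
qed

lemma finite_bell_indices: "finite (bell_indices n k)"
proof (rule finite_subset)
  show "bell_indices n k \<subseteq>
          {l. \<forall>i. (i \<in> {1..n - k + 1} \<longrightarrow> l i \<in> {..k}) \<and> (i \<notin> {1..n - k + 1} \<longrightarrow> l i = 0)}"
  proof (intro subsetI CollectI allI conjI impI)
    fix l i assume l: "l \<in> bell_indices n k"
    show "l i \<in> {..k}"
    proof (cases "l i = 0")
      case False
      have "l i \<le> (\<Sum>j | l j \<noteq> 0. l j)"
        by (rule member_le_sum) (use l False in \<open>auto simp: bell_indices_def\<close>)
      then show ?thesis using l by (simp add: bell_indices_def)
    qed simp
  next
    fix l i assume "l \<in> bell_indices n k" "i \<notin> {1..n - k + 1}"
    then show "l i = 0" using bell_indices_support by blast
  qed
  show "finite {l. \<forall>i. (i \<in> {1..n - k + 1} \<longrightarrow> l i \<in> {..k}) \<and>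
                      (i \<notin> {1..n - k + 1} \<longrightarrow> l i = (0::nat))}"
    by (rule finite_set_of_finite_funs) auto
qed

end

theory Submission
  imports Defs "HOL-Computational_Algebra.Formal_Power_Series"
begin

text \<open>
  Put \<open>g = (\<Sum>m\<ge>1. (\<lambda>\<^sub>m / m!) X\<^sup>m)\<close>. The powers of \<open>g\<close> generate the Bell polynomials:
  \<open>k! B\<^sub>n\<^sub>,\<^sub>k(\<lambda>) / n!\<close> is the coefficient of \<open>X\<^sup>n\<close> in \<open>g\<^sup>k\<close> (\<open>partial_bell_eq_fps_power_nth\<close>). Hence
  the right-hand side of the theorem is the coefficient of \<open>X\<^sup>n\<close> in the geometric series
  \<open>(\<Sum>k. (-g)\<^sup>k) = 1 / (1 + g)\<close>, in which the powers beyond the \<open>n\<close>-th do not contribute. What has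
  to be shown is that \<open>1 + g\<close> is inverse to the generating function of the partition numbers.

  The closed form of \<open>\<lambda>\<^sub>m\<close> says that \<open>1 + g\<close> is the pentagonal number series: the number
  \<open>(1 + sqrt (1 + 24 m)) / 6\<close> is an integer \<open>s\<close> precisely when \<open>m = s (3 s - 1) / 2\<close>, and the conjugate
  root covers the indices \<open>s < 0\<close> (\<open>pent_lambda_eq_sum\<close>). So the claim amounts to Euler's pentagonal
  number theorem. Infinite products are avoided by working, for each \<open>n\<close>, with the finite product
  \<open>(1 - X) \<dots> (1 - X\<^sup>n)\<close>. It is inverse to the generating function of the partitions into parts
  of size at most \<open>n\<close> (\<open>partitions_upto_gf\<close>), whose coefficients up to degree \<open>n\<close> are the partition
  numbers. On the other side, a finite identity due to Shanks (\<open>shanks_identity\<close>) shows that the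
  product agrees with the pentagonal number series up to degree \<open>n\<close> (\<open>euler_product_nth\<close>).
\<close>

unbundle fps_syntax

section \<open>Truncations of the pentagonal number series\<close>

text \<open>
  The left-hand side deforms the product \<open>(1 - q) \<dots> (1 - q\<^sup>n)\<close>, its summand for \<open>s = 0\<close>, by terms
  of higher order in \<open>q\<close>, chosen so that the sum becomes sparse. Writing \<open>T n s\<close> for the summands,
  passing from \<open>n\<close> to \<open>n + 1\<close> changes each \<open>T n s\<close> by a difference \<open>G (s + 1) - G s\<close>. The sum
  over \<open>s \<le> n\<close> telescopes to \<open>G (n + 1)\<close>, which is the first of the two new pentagonal powers,
  while the additional summand \<open>T (n + 1) (n + 1)\<close> is the second.
\<close>

lemma shanks_identity:
  fixes q :: "'a :: comm_ring_1"
  shows "(\<Sum>s=0..n. (-1) ^ s * (\<Prod>j=s+1..n. 1 - q ^ j) * q ^ (s * n + s * (s + 1) div 2)) =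
         1 + (\<Sum>s=1..n. (-1) ^ s * (q ^ (s * (3 * s - 1) div 2) + q ^ (s * (3 * s + 1) div 2)))"
proof (induction n)
  case 0
  then show ?case by simp
next
  case (Suc n)
  define T where "T m s = (-1) ^ s * (\<Prod>j=s+1..m. 1 - q ^ j) * q ^ (s * m + s * (s + 1) div 2)"
    for m s
  define G where "G s = (-1) ^ s * (\<Prod>j=s..n. 1 - q ^ j) * q ^ (s * n + s * (s + 1) div 2)" for s
  have step: "T (Suc n) s - T n s = G (Suc s) - G s" if "s \<le> n" for s
  proof -
    define Q where "Q = (\<Prod>j=s+1..n. 1 - q ^ j)"
    define e where "e = s * n + s * (s + 1) div 2"
    have TS: "T (Suc n) s = (-1) ^ s * (Q * (1 - q ^ Suc n)) * (q ^ s * q ^ e)"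
      using that by (simp add: T_def Q_def e_def power_add mult_ac)
    have "Suc s * (Suc s + 1) div 2 = s * (s + 1) div 2 + Suc s"
    proof -
      have "Suc s * (Suc s + 1) = s * (s + 1) + Suc s * 2" by (simp add: algebra_simps)
      then show ?thesis by simp
    qed
    then have "Suc s * n + Suc s * (Suc s + 1) div 2 = e + Suc n + s"
      by (simp add: e_def)
    then have "G (Suc s) = (-1) ^ Suc s * Q * q ^ (e + Suc n + s)"
      by (simp only: G_def Q_def) simp
    then have G1: "G (Suc s) = - ((-1) ^ s * Q * (q ^ s * q ^ Suc n * q ^ e))"
      by (simp add: power_add mult_ac)
    have G0: "G s = (-1) ^ s * ((1 - q ^ s) * Q) * q ^ e"
    proof -
      have "(\<Prod>j=s..n. 1 - q ^ j) = (1 - q ^ s) * Q"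
        unfolding Q_def using that by (simp add: prod.atLeast_Suc_atMost)
      then show ?thesis by (simp add: G_def e_def)
    qed
    have T0: "T n s = (-1) ^ s * Q * q ^ e" by (simp add: T_def Q_def e_def)
    show ?thesis unfolding TS T0 G1 G0 by (simp add: algebra_simps)
  qed
  have e1: "Suc n * n + Suc n * (Suc n + 1) div 2 = Suc n * (3 * Suc n - 1) div 2"
  proof -
    have "Suc n * (3 * Suc n - 1) = Suc n * (Suc n + 1) + (Suc n * n) * 2"
      by (simp add: algebra_simps)
    then show ?thesis by simp
  qed
  have e2: "Suc n * Suc n + Suc n * (Suc n + 1) div 2 = Suc n * (3 * Suc n + 1) div 2"
  proof -
    have "Suc n * (3 * Suc n + 1) = Suc n * (Suc n + 1) + (Suc n * Suc n) * 2"
      by (simp add: algebra_simps)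
    then show ?thesis by simp
  qed
  have "(\<Sum>s=0..n. T (Suc n) s) - (\<Sum>s=0..n. T n s) = (\<Sum>s=0..n. G (Suc s) - G s)"
    using step by (simp flip: sum_subtractf)
  \<comment> \<open>The lower end \<open>G 0\<close> of the telescope vanishes, because its product has the factor \<open>1 - q ^ 0\<close>.\<close>
  also have "\<dots> = G (Suc n)"
    by (subst sum_Suc_diff) (auto simp: G_def prod.atLeast_Suc_atMost)
  also have "\<dots> = (-1) ^ Suc n * q ^ (Suc n * (3 * Suc n - 1) div 2)"
    unfolding e1[symmetric] by (simp add: G_def)
  finally have "(\<Sum>s=0..Suc n. T (Suc n) s) = (\<Sum>s=0..n. T n s) +
      (-1) ^ Suc n * q ^ (Suc n * (3 * Suc n - 1) div 2) + T (Suc n) (Suc n)"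
    by (simp add: algebra_simps)
  moreover have "T (Suc n) (Suc n) = (-1) ^ Suc n * q ^ (Suc n * (3 * Suc n + 1) div 2)"
    unfolding e2[symmetric] by (simp add: T_def)
  ultimately show ?case
    using Suc.IH by (simp add: T_def distrib_left del: power_Suc mult_Suc mult_Suc_right)
qed

text \<open>
  The summands of Shanks' identity with \<open>s \<ge> 1\<close> are divisible by \<open>q ^ (n + 1)\<close>, so that in degrees
  up to \<open>n\<close> only the product itself remains on the left.
\<close>

lemma euler_product_nth:
  assumes "m \<le> n"
  shows "(\<Prod>j=1..n. 1 - fps_X ^ j :: 'a :: comm_ring_1 fps) $ m =
         (if m = 0 then 1 else 0) + (\<Sum>s=1..n. (-1) ^ s *
           ((if m = s * (3 * s - 1) div 2 then 1 else 0) +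
            (if m = s * (3 * s + 1) div 2 then 1 else 0)))"
proof -
  define F where "F s = (-1) ^ s * (\<Prod>j=s+1..n. 1 - fps_X ^ j :: 'a fps) *
    fps_X ^ (s * n + s * (s + 1) div 2)" for s
  have sgn: "((-1) ^ s * f :: 'a fps) $ m = (-1) ^ s * f $ m" for s f
    by (cases "even s") auto
  have "F s $ m = 0" if "s \<in> {1..n}" for s
  proof -
    have "m < s * n + s * (s + 1) div 2"
    proof -
      have "n \<le> s * n" and "1 * 2 \<le> s * (s + 1)"
        using that by (simp, intro mult_le_mono) auto
      then show ?thesis using assms by linarith
    qed
    then show ?thesis by (simp add: F_def fps_X_power_mult_right_nth)
  qed
  then have "(\<Sum>s=0..n. F s) $ m = F 0 $ m"
    by (simp add: sum.atLeast_Suc_atMost fps_sum_nth)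
  then have "(\<Prod>j=1..n. 1 - fps_X ^ j :: 'a fps) $ m = (\<Sum>s=0..n. F s) $ m"
    by (simp add: F_def)
  also have "(\<Sum>s=0..n. F s) = 1 + (\<Sum>s=1..n. (-1) ^ s *
      (fps_X ^ (s * (3 * s - 1) div 2) + fps_X ^ (s * (3 * s + 1) div 2)))"
    unfolding F_def by (rule shanks_identity)
  finally show ?thesis
    by (simp add: fps_sum_nth sgn fps_X_power_nth del: One_nat_def)
qed

text \<open>
  This bounds the indices \<open>s\<close> that can contribute to the coefficient of \<open>X ^ m\<close> by \<open>m\<close>, so that a
  sum over \<open>1 \<le> s \<le> n\<close> catches all of them when \<open>m \<le> n\<close>.
\<close>

lemma le_pentagonal:
  fixes s :: nat
  assumes "1 \<le> s"
  shows "s \<le> s * (3 * s - 1) div 2" "s \<le> s * (3 * s + 1) div 2"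
proof -
  have "s * 2 \<le> s * (3 * s - 1)" "s * 2 \<le> s * (3 * s + 1)"
    using assms by (intro mult_le_mono; simp)+
  then show "s \<le> s * (3 * s - 1) div 2" "s \<le> s * (3 * s + 1) div 2" by linarith+
qed

lemma sqrt_eq_iff_eq_power2: "0 \<le> x \<Longrightarrow> 0 \<le> y \<Longrightarrow> sqrt x = y \<longleftrightarrow> x = y\<^sup>2"
  by (metis real_sqrt_pow2 real_sqrt_unique)

lemma sqrt_pentagonal_minus_iff:
  fixes m s :: nat
  assumes "1 \<le> s"
  shows "(1 + sqrt (1 + 24 * real m)) / 6 = real s \<longleftrightarrow> m = s * (3 * s - 1) div 2"
proof -
  have ev: "even (s * (3 * s - 1))" using assms by auto
  have "(1 + sqrt (1 + 24 * real m)) / 6 = real s \<longleftrightarrow> sqrt (1 + 24 * real m) = 6 * real s - 1"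
    by auto
  also have "\<dots> \<longleftrightarrow> 1 + 24 * real m = (6 * real s - 1)\<^sup>2"
    using assms by (intro sqrt_eq_iff_eq_power2) auto
  also have "\<dots> \<longleftrightarrow> real (2 * m) = real (s * (3 * s - 1))"
    using assms by (auto simp: power2_eq_square of_nat_diff algebra_simps)
  also have "\<dots> \<longleftrightarrow> m = s * (3 * s - 1) div 2"
    using ev unfolding of_nat_eq_iff by auto
  finally show ?thesis .
qed

lemma sqrt_pentagonal_plus_iff:
  fixes m s :: nat
  shows "(1 - sqrt (1 + 24 * real m)) / 6 = - real s \<longleftrightarrow> m = s * (3 * s + 1) div 2"
proof -
  have ev: "even (s * (3 * s + 1))" by auto
  have "(1 - sqrt (1 + 24 * real m)) / 6 = - real s \<longleftrightarrow> sqrt (1 + 24 * real m) = 6 * real s + 1"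
    by auto
  also have "\<dots> \<longleftrightarrow> 1 + 24 * real m = (6 * real s + 1)\<^sup>2"
    by (intro sqrt_eq_iff_eq_power2) auto
  also have "\<dots> \<longleftrightarrow> real (2 * m) = real (s * (3 * s + 1))"
    by (auto simp: power2_eq_square algebra_simps)
  also have "\<dots> \<longleftrightarrow> m = s * (3 * s + 1) div 2"
    using ev unfolding of_nat_eq_iff by auto
  finally show ?thesis .
qed

text \<open>
  At most one indicator on the right is nonzero, because the two numbers tested in the definition
  of \<open>\<lambda>\<^sub>m\<close> have sum 1/3 and therefore cannot both be integers. For \<open>m \<ge> 1\<close> the first number is positive and the second
  is negative, which is why positive indices \<open>s\<close> suffice.
\<close>

lemma pent_lambda_eq_sum:
  assumes "1 \<le> m" "m \<le> n"
  shows "pent_lambda m / fact m = (\<Sum>s=1..n. (-1) ^ s *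
           ((if m = s * (3 * s - 1) div 2 then 1 else 0) +
            (if m = s * (3 * s + 1) div 2 then 1 else 0)))"
proof -
  define u where "u = (1 + sqrt (1 + 24 * real m)) / 6"
  define v where "v = (1 - sqrt (1 + 24 * real m)) / 6"
  have u_pos: "u > 0" and v_neg: "v < 0"
    using assms unfolding u_def v_def by (simp_all add: add_pos_nonneg)
  have uv: "3 * (u + v) = 1" by (simp add: u_def v_def field_simps)
  have not_both: "\<not> (u \<in> \<int> \<and> v \<in> \<int>)"
  proof
    assume "u \<in> \<int> \<and> v \<in> \<int>"
    then obtain i j where "u = of_int i" "v = of_int j" by (auto elim!: Ints_cases)
    with uv have "of_int (3 * (i + j)) = (of_int 1 :: real)" by simp
    then have "3 * (i + j) = 1" unfolding of_int_eq_iff .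
    then show False by presburger
  qed
  have "(\<Sum>s=1..n. (-1) ^ s *
           ((if m = s * (3 * s - 1) div 2 then 1 else 0) +
            (if m = s * (3 * s + 1) div 2 then 1 else 0))) =
        (\<Sum>s=1..n. (-1) ^ s * ((if u = real s then 1 else 0) + (if v = - real s then 1 else 0)))"
    unfolding u_def v_def
    by (intro sum.cong refl)
       (simp only: sqrt_pentagonal_minus_iff sqrt_pentagonal_plus_iff atLeastAtMost_iff)
  also have "\<dots> = pent_lambda m / fact m"
  proof (cases "u \<in> \<int>")
    case True
    then obtain i where i: "u = of_int i" by (auto elim!: Ints_cases)
    have "i > 0" using i u_pos by simp
    then obtain t where t: "u = real t" "1 \<le> t"
      using i by (metis of_int_of_nat_eq pos_int_cases Suc_leI One_nat_def)
    have tm: "t \<le> n"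
      using sqrt_pentagonal_minus_iff[OF t(2), of m] le_pentagonal(1)[OF t(2)] t assms(2) by (simp add: u_def)
    have "v \<noteq> - real s" for s using not_both True by auto
    then have "(\<Sum>s=1..n. (-1) ^ s * ((if u = real s then 1 else 0) + (if v = - real s then 1 else 0)))
        = (\<Sum>s=1..n. if s = t then (-1) ^ t else (0::real))"
      by (intro sum.cong) (auto simp: t(1))
    also have "\<dots> = (-1) ^ t" using t tm by simp
    also have "\<dots> = pent_lambda m / fact m"
      using True t(1) by (simp add: pent_lambda_def flip: u_def)
    finally show ?thesis .
  next
    case False
    note notu = this
    have nu: "u \<noteq> real s" for s using False by auto
    show ?thesis
    proof (cases "v \<in> \<int>")
      case True
      then obtain i where i: "v = of_int i" by (auto elim!: Ints_cases)
      have "- i > 0" using i v_neg by simp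
      then obtain t where t': "- i = int t" "1 \<le> t"
        by (metis pos_int_cases Suc_leI One_nat_def)
      then have "i = - int t" by simp
      with i t' have t: "v = - real t" "1 \<le> t" by simp_all
      have tm: "t \<le> n"
        using sqrt_pentagonal_plus_iff[of m t] le_pentagonal(2)[OF t(2)] t assms(2) by (simp add: v_def)
      have "(\<Sum>s=1..n. (-1) ^ s * ((if u = real s then 1 else 0) + (if v = - real s then 1 else 0)))
          = (\<Sum>s=1..n. if s = t then (-1) ^ t else (0::real))"
        using nu by (intro sum.cong) (auto simp: t(1))
      also have "\<dots> = (-1) ^ t" using t tm by simp
      also have "\<dots> = (-1) powi \<lfloor>v\<rfloor>"
        unfolding i \<open>i = - int t\<close> floor_of_int by (simp add: power_int_minus flip: power_inverse)
      also have "\<dots> = pent_lambda m / fact m"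
        using notu True by (simp add: pent_lambda_def flip: u_def v_def)
      finally show ?thesis .
    next
      case False
      then have "v \<noteq> - real s" for s by auto
      then show ?thesis using nu notu False by (simp add: pent_lambda_def flip: u_def v_def)
    qed
  qed
  finally show ?thesis ..
qed

section \<open>Partitions with bounded parts\<close>

definition partitions_upto :: "nat \<Rightarrow> nat \<Rightarrow> nat multiset set" where
  "partitions_upto N n = {M. 0 \<notin># M \<and> (\<forall>x\<in>#M. x \<le> N) \<and> sum_mset M = n}"

lemma finite_partitions_upto [simp]: "finite (partitions_upto N n)"
  by (rule finite_subset[OF _ finite_partitions[of n]]) (auto simp: partitions_upto_def)

lemma partitions_upto_0: "partitions_upto 0 n = (if n = 0 then {{#}} else {})"
proof -
  have "M = {#}" if "M \<in> partitions_upto 0 n" for M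
    using that by (cases M) (auto simp: partitions_upto_def)
  moreover have "{#} \<in> partitions_upto 0 n \<longleftrightarrow> n = 0"
    by (auto simp: partitions_upto_def)
  ultimately show ?thesis by auto
qed

text \<open>A part of the maximal size \<open>N + 1\<close> is either absent, or one copy of it can be removed.\<close>

lemma card_partitions_upto_Suc:
  "card (partitions_upto (Suc N) n) =
     card (partitions_upto N n) +
     (if Suc N \<le> n then card (partitions_upto (Suc N) (n - Suc N)) else 0)"
proof -
  let ?B = "{M \<in> partitions_upto (Suc N) n. Suc N \<in># M}"
  have "partitions_upto (Suc N) n = partitions_upto N n \<union> ?B"
    by (auto simp: partitions_upto_def le_Suc_eq)
  moreover have "partitions_upto N n \<inter> ?B = {}"
    by (auto simp: partitions_upto_def)
  moreover have "finite ?B" by simp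
  ultimately have "card (partitions_upto (Suc N) n) = card (partitions_upto N n) + card ?B"
    by (metis card_Un_disjoint finite_partitions_upto)
  moreover have "card ?B = (if Suc N \<le> n then card (partitions_upto (Suc N) (n - Suc N)) else 0)"
  proof (cases "Suc N \<le> n")
    case True
    have "?B = add_mset (Suc N) ` partitions_upto (Suc N) (n - Suc N)"
    proof (intro equalityI subsetI)
      fix M assume M: "M \<in> ?B"
      then obtain M' where "M = add_mset (Suc N) M'" by (auto dest: multi_member_split)
      with M show "M \<in> add_mset (Suc N) ` partitions_upto (Suc N) (n - Suc N)"
        by (auto simp: partitions_upto_def)
    qed (use True in \<open>auto simp: partitions_upto_def\<close>)
    moreover have "inj_on (add_mset (Suc N)) A" for A by (auto simp: inj_on_def)
    ultimately show ?thesis using True by (simp add: card_image)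
  next
    case False
    have "?B = {}"
    proof (intro equals0I)
      fix M assume M: "M \<in> ?B"
      then obtain M' where "M = add_mset (Suc N) M'" by (auto dest: multi_member_split)
      with M False show False by (auto simp: partitions_upto_def)
    qed
    then show ?thesis using False by simp
  qed
  ultimately show ?thesis by simp
qed

text \<open>
  By the preceding recurrence, multiplication by \<open>1 - X ^ (N + 1)\<close> turns the generating function for
  the bound \<open>N + 1\<close> into the one for \<open>N\<close>; for the bound 0 it is 1.
\<close>

lemma partitions_upto_gf:
  "Abs_fps (\<lambda>n. of_nat (card (partitions_upto N n))) * (\<Prod>j=1..N. 1 - fps_X ^ j) =
     (1 :: 'a :: comm_ring_1 fps)"
proof (induction N)
  case 0
  show ?case by (rule fps_ext) (simp add: partitions_upto_0)
next
  case (Suc N)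
  have "Abs_fps (\<lambda>n. of_nat (card (partitions_upto (Suc N) n))) * (1 - fps_X ^ Suc N) =
        (Abs_fps (\<lambda>n. of_nat (card (partitions_upto N n))) :: 'a fps)"
    by (rule fps_ext)
       (auto simp: right_diff_distrib fps_X_power_mult_right_nth
          card_partitions_upto_Suc[of N] simp del: power_Suc)
  then have "Abs_fps (\<lambda>n. of_nat (card (partitions_upto (Suc N) n))) *
        ((1 - fps_X ^ Suc N) * (\<Prod>j=1..N. 1 - fps_X ^ j)) = (1 :: 'a fps)"
    using Suc.IH by (simp only: mult.assoc[symmetric])
  then show ?case by (simp add: mult.commute del: power_Suc)
qed

lemma card_partitions_upto_eq_partition_number:
  assumes "n \<le> N"
  shows "card (partitions_upto N n) = partition_number n"
proof -
  have "x \<le> n" if "x \<in># M" "sum_mset M = n" for x and M :: "nat multiset"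
    using that by (auto dest: multi_member_split)
  then have "partitions_upto N n = {M. 0 \<notin># M \<and> sum_mset M = n}"
    using assms by (auto simp: partitions_upto_def intro: order.trans)
  then show ?thesis by (simp add: partition_number_def)
qed

section \<open>Partial Bell polynomials as coefficients of powers\<close>

text \<open>
  Sums over a fixed range, in place of the support of \<open>l\<close>, can be compared when an entry of \<open>l\<close>
  changes and possibly leaves the support. The range may be any sufficiently long one, so that a
  single \<open>N\<close> serves for \<open>n\<close> and all \<open>n - m\<close> in the recurrence below.
\<close>

lemma bell_indices_eq:
  assumes "n \<le> N"
  shows "bell_indices n k =
    {l. l 0 = 0 \<and> (\<forall>i>N. l i = 0) \<and> (\<Sum>i=1..N. i * l i) = n \<and> (\<Sum>i=1..N. l i) = k}"
proof -
  have *: "(\<Sum>i | l i \<noteq> 0. f i * l i) = (\<Sum>i=1..N. f i * l i)"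
    if "l 0 = 0" "\<forall>i>N. l i = 0" for l f :: "nat \<Rightarrow> nat"
  proof (rule sum.mono_neutral_left)
    show "{i. l i \<noteq> 0} \<subseteq> {1..N}"
      using that by (metis (mono_tags, lifting) atLeastAtMost_iff less_one mem_Collect_eq not_less subsetI)
  qed auto
  have 1: "(\<Sum>i | l i \<noteq> 0. l i) = (\<Sum>i=1..N. l i)"
    if "l 0 = 0" "\<forall>i>N. l i = 0" for l :: "nat \<Rightarrow> nat"
    using *[OF that, of "\<lambda>_. 1"] by simp
  have fin: "finite {i. l i \<noteq> 0}" if "\<forall>i>N. l i = 0" for l :: "nat \<Rightarrow> nat"
    by (rule finite_subset[of _ "{..N}"]) (use that in \<open>auto intro: leI\<close>)
  have supp: "\<forall>i>N. l i = 0" if "finite {i. l i \<noteq> 0}" "(\<Sum>i | l i \<noteq> 0. i * l i) = n"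
    for l :: "nat \<Rightarrow> nat"
  proof (intro allI impI, rule ccontr)
    fix i assume i: "N < i" "l i \<noteq> 0"
    then have "i * l i \<le> n"
      using that member_le_sum[of i "{i. l i \<noteq> 0}" "\<lambda>i. i * l i"] by simp
    moreover have "i \<le> i * l i" using i by simp
    ultimately show False using i assms by linarith
  qed
  show ?thesis
  proof (intro equalityI subsetI CollectI)
    fix l assume l: "l \<in> bell_indices n k"
    then have "l 0 = 0" "\<forall>i>N. l i = 0" using supp by (auto simp: bell_indices_def)
    with l * [of l "\<lambda>i. i"] 1[of l]
    show "l 0 = 0 \<and> (\<forall>i>N. l i = 0) \<and> (\<Sum>i=1..N. i * l i) = n \<and> (\<Sum>i=1..N. l i) = k"
      by (simp add: bell_indices_def)
  next
    fix l :: "nat \<Rightarrow> nat"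
    assume l: "l \<in> {l. l 0 = 0 \<and> (\<forall>i>N. l i = 0) \<and> (\<Sum>i=1..N. i * l i) = n \<and> (\<Sum>i=1..N. l i) = k}"
    then show "l \<in> bell_indices n k"
      using * [of l "\<lambda>i. i"] 1[of l] fin[of l] by (simp add: bell_indices_def)
  qed
qed

definition bell_term :: "nat \<Rightarrow> (nat \<Rightarrow> real) \<Rightarrow> (nat \<Rightarrow> nat) \<Rightarrow> real" where
  "bell_term N a l = (\<Prod>i=1..N. a i ^ l i / fact (l i))"

lemma partial_bell_eq_sum_bell_term:
  assumes "n \<le> N"
  shows "partial_bell n k x =
    fact n * (\<Sum>l\<in>bell_indices n k. bell_term N (\<lambda>i. x i / fact i) l)"
  unfolding partial_bell_def sum_distrib_left
proof (rule sum.cong)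
  fix l assume l: "l \<in> bell_indices n k"
  let ?f = "\<lambda>i. (x i / fact i) ^ l i / fact (l i)"
  have "l i = 0" if "i > N" for i using l that unfolding bell_indices_eq[OF assms] by blast
  then have "l i \<noteq> 0 \<Longrightarrow> i \<in> {1..N}" for i
    using l by (cases "i = 0") (auto simp: bell_indices_def Suc_le_eq intro: leI)
  then have "(\<Prod>i=1..N. ?f i) = (\<Prod>i | l i \<noteq> 0. ?f i)"
    by (intro prod.mono_neutral_right) auto
  also have "\<dots> = (\<Prod>i=1..n - k + 1. ?f i)"
    using bell_indices_support[OF l] by (intro prod.mono_neutral_left) auto
  finally show "fact n / (\<Prod>i=1..n - k + 1. fact (l i)) * (\<Prod>i=1..n - k + 1. (x i / fact i) ^ l i) =
      fact n * bell_term N (\<lambda>i. x i / fact i) l"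
    by (simp add: bell_term_def prod_dividef)
qed simp

lemma bell_term_remove:
  assumes "m \<in> {1..N}" "l m > 0"
  shows "real (l m) * bell_term N a l = a m * bell_term N a (l(m := l m - 1))"
proof -
  obtain t where t: "l m = Suc t" using assms(2) gr0_conv_Suc by blast
  have "(\<Prod>i\<in>{1..N} - {m}. a i ^ l i / fact (l i)) =
        (\<Prod>i\<in>{1..N} - {m}. a i ^ (l(m := l m - 1)) i / fact ((l(m := l m - 1)) i))"
    by (rule prod.cong) auto
  then show ?thesis
    unfolding bell_term_def using assms(1)
    by (simp add: prod.remove[of _ m] t field_simps del: of_nat_Suc)
qed

text \<open>
  The recurrence behind \<open>g\<^sup>k\<^sup>+\<^sup>1 = g g\<^sup>k\<close>. For \<open>l\<close> with \<open>k + 1\<close> entries in total, counted with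
  multiplicity, the factor \<open>k + 1\<close> is the sum of the multiplicities \<open>l m\<close>. Distributing it and
  cancelling \<open>l m\<close> against \<open>fact (l m)\<close> removes one entry \<open>m\<close> from \<open>l\<close>; for each \<open>m\<close> this is a
  bijection from the index sequences with \<open>l m > 0\<close> onto those for \<open>n - m\<close> and \<open>k\<close>.
\<close>

lemma sum_bell_term_Suc:
  assumes "n \<le> N"
  shows "real (Suc k) * (\<Sum>l\<in>bell_indices n (Suc k). bell_term N a l) =
    (\<Sum>m=1..n. a m * (\<Sum>l\<in>bell_indices (n - m) k. bell_term N a l))"
proof -
  have shift: "(\<Sum>i=1..N. c i * (l(m := v)) i) + c m * l m = (\<Sum>i=1..N. c i * l i) + c m * v"
    if "m \<in> {1..N}" for c l :: "nat \<Rightarrow> nat" and m v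
  proof -
    have "(\<Sum>i\<in>{1..N} - {m}. c i * (l(m := v)) i) = (\<Sum>i\<in>{1..N} - {m}. c i * l i)"
      by (rule sum.cong) auto
    then show ?thesis using that by (simp add: sum.remove[of _ m])
  qed
  have shift1: "(\<Sum>i=1..N. (l(m := v)) i) + l m = (\<Sum>i=1..N. l i) + v"
    if "m \<in> {1..N}" for l :: "nat \<Rightarrow> nat" and m v
    using shift[OF that, of "\<lambda>_. 1"] by simp
  have "real (Suc k) * (\<Sum>l\<in>bell_indices n (Suc k). bell_term N a l) =
      (\<Sum>l\<in>bell_indices n (Suc k). \<Sum>m=1..n. real (l m) * bell_term N a l)"
    unfolding sum_distrib_left
  proof (rule sum.cong)
    fix l assume l: "l \<in> bell_indices n (Suc k)"
    then have "Suc k = (\<Sum>m=1..n. l m)" unfolding bell_indices_eq[OF order.refl] by simp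
    then show "real (Suc k) * bell_term N a l = (\<Sum>m=1..n. real (l m) * bell_term N a l)"
      by (simp only: of_nat_sum sum_distrib_right)
  qed simp
  also have "\<dots> = (\<Sum>m=1..n. \<Sum>l\<in>bell_indices n (Suc k). real (l m) * bell_term N a l)"
    by (rule sum.swap)
  also have "\<dots> = (\<Sum>m=1..n. a m * (\<Sum>l\<in>bell_indices (n - m) k. bell_term N a l))"
  proof (rule sum.cong)
    fix m assume m: "m \<in> {1..n}"
    then have mN: "m \<in> {1..N}" and nmN: "n - m \<le> N" using assms by auto
    have "(\<Sum>l\<in>bell_indices n (Suc k). real (l m) * bell_term N a l) =
        (\<Sum>l\<in>{l \<in> bell_indices n (Suc k). l m > 0}. real (l m) * bell_term N a l)"
      by (rule sum.mono_neutral_right) (auto simp: finite_bell_indices)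
    also have "\<dots> = (\<Sum>l\<in>bell_indices (n - m) k. a m * bell_term N a l)"
    proof (rule sum.reindex_bij_witness[where j = "\<lambda>l. l(m := l m - 1)" and i = "\<lambda>l. l(m := l m + 1)"])
      fix l assume l: "l \<in> {l \<in> bell_indices n (Suc k). l m > 0}"
      then show "(l(m := l m - 1))(m := (l(m := l m - 1)) m + 1) = l" by auto
      from l have lm: "l m > 0" by simp
      have "(\<Sum>i=1..N. i * (l(m := l m - 1)) i) + m * l m = n + m * (l m - 1)"
        "(\<Sum>i=1..N. (l(m := l m - 1)) i) + l m = Suc k + (l m - 1)"
        using l shift[OF mN, of "\<lambda>i. i" l "l m - 1"] shift1[OF mN, of l "l m - 1"]
        unfolding bell_indices_eq[OF assms] by auto
      moreover have "m * l m = m * (l m - 1) + m"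
        using lm by (cases "l m") auto
      ultimately have "(\<Sum>i=1..N. i * (l(m := l m - 1)) i) = n - m"
        "(\<Sum>i=1..N. (l(m := l m - 1)) i) = k"
        using lm m by linarith+
      then show "l(m := l m - 1) \<in> bell_indices (n - m) k"
        using l mN unfolding bell_indices_eq[OF assms] bell_indices_eq[OF nmN] by auto
      show "a m * bell_term N a (l(m := l m - 1)) = real (l m) * bell_term N a l"
        using bell_term_remove[where l = l and a = a, OF mN lm] by simp
    next
      fix l assume l: "l \<in> bell_indices (n - m) k"
      then show "(l(m := l m + 1))(m := (l(m := l m + 1)) m - 1) = l" by auto
      have "(\<Sum>i=1..N. i * (l(m := l m + 1)) i) + m * l m = n - m + m * (l m + 1)"
        "(\<Sum>i=1..N. (l(m := l m + 1)) i) + l m = k + (l m + 1)"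
        using l shift[OF mN, of "\<lambda>i. i" l "l m + 1"] shift1[OF mN, of l "l m + 1"]
        unfolding bell_indices_eq[OF nmN] by auto
      moreover have "m * (l m + 1) = m * l m + m" by simp
      ultimately have "(\<Sum>i=1..N. i * (l(m := l m + 1)) i) = n"
        "(\<Sum>i=1..N. (l(m := l m + 1)) i) = Suc k"
        using m unfolding atLeastAtMost_iff by linarith+
      then show "l(m := l m + 1) \<in> {l \<in> bell_indices n (Suc k). l m > 0}"
        using l mN unfolding bell_indices_eq[OF assms] bell_indices_eq[OF nmN] by auto
    qed
    finally show "(\<Sum>l\<in>bell_indices n (Suc k). real (l m) * bell_term N a l) =
        a m * (\<Sum>l\<in>bell_indices (n - m) k. bell_term N a l)"
      by (simp add: sum_distrib_left)
  qed simp
  finally show ?thesis .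
qed

text \<open>The multinomial theorem for power series, in the form that the recurrence yields.\<close>

lemma sum_bell_term_eq_fps_power_nth:
  assumes "n \<le> N" "g $ 0 = 0"
  shows "fact k * (\<Sum>l\<in>bell_indices n k. bell_term N (fps_nth g) l) = (g ^ k) $ n"
  using assms(1)
proof (induction k arbitrary: n)
  case 0
  have "bell_indices n 0 = (if n = 0 then {\<lambda>_. 0} else {})"
    using bell_indices_support by (auto simp: bell_indices_def)
  then show ?case by (simp add: bell_term_def)
next
  case (Suc k)
  have "fact (Suc k) * (\<Sum>l\<in>bell_indices n (Suc k). bell_term N (fps_nth g) l) =
      fact k * (real (Suc k) * (\<Sum>l\<in>bell_indices n (Suc k). bell_term N (fps_nth g) l))"
    by simp
  also have "\<dots> =
      (\<Sum>m=1..n. g $ m * (fact k * (\<Sum>l\<in>bell_indices (n - m) k. bell_term N (fps_nth g) l)))"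
    unfolding sum_bell_term_Suc[OF Suc.prems] by (simp add: sum_distrib_left mult_ac)
  also have "\<dots> = (\<Sum>m=1..n. g $ m * (g ^ k) $ (n - m))"
    using Suc by (intro sum.cong) auto
  also have "\<dots> = (g ^ Suc k) $ n"
    by (simp add: fps_mult_nth sum.atLeast_Suc_atMost assms(2))
  finally show ?case .
qed

lemma partial_bell_eq_fps_power_nth:
  fixes x :: "nat \<Rightarrow> real"
  shows "fact k * partial_bell n k x =
    fact n * (Abs_fps (\<lambda>m. if m = 0 then 0 else x m / fact m) ^ k) $ n"
proof -
  let ?g = "Abs_fps (\<lambda>m. if m = 0 then 0 else x m / fact m)"
  have "bell_term n (\<lambda>i. x i / fact i) = bell_term n (fps_nth ?g)"
    by (auto simp: bell_term_def fun_eq_iff intro!: prod.cong)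
  then show ?thesis
    using sum_bell_term_eq_fps_power_nth[of n n ?g k]
    by (simp add: partial_bell_eq_sum_bell_term[of n n])
qed

section \<open>The partition function\<close>

text \<open>
  The coefficient of \<open>X ^ n\<close> in a product depends on the factors only up to degree \<open>n\<close>. There
  they may be replaced by the generating function of the partitions into parts of size at most \<open>n\<close>
  and by the product \<open>(1 - X) \<dots> (1 - X ^ n)\<close>, which are inverse to each other.
\<close>

lemma partition_number_gf_mult_pentagonal:
  "Abs_fps (\<lambda>n. real (partition_number n)) *
     (1 + Abs_fps (\<lambda>m. if m = 0 then 0 else pent_lambda m / fact m)) = 1"
    (is "?P * ?E = 1")
proof (rule fps_ext)
  fix n
  let ?R = "Abs_fps (\<lambda>m. real (card (partitions_upto n m)))"
  let ?F = "\<Prod>j=1..n. 1 - fps_X ^ j :: real fps"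
  have E: "?E $ m = ?F $ m" if "m \<le> n" for m
  proof (cases "m = 0")
    case True
    have "0 \<noteq> s * (3 * s - 1) div 2" "0 \<noteq> s * (3 * s + 1) div 2" if "s \<in> {1..n}" for s
      using le_pentagonal[of s] that unfolding atLeastAtMost_iff by linarith+
    then have "?F $ 0 = 1 + (\<Sum>s=1..n. 0)"
      unfolding euler_product_nth[OF le0]
      by (intro arg_cong2[where f = plus] sum.cong refl) (simp_all only: if_True if_False, simp_all)
    then show ?thesis using True by simp
  next
    case False
    then show ?thesis
      unfolding euler_product_nth[OF that] using that by (simp add: pent_lambda_eq_sum[of m n])
  qed
  have P: "?P $ m = ?R $ m" if "m \<le> n" for m
    using that by (simp add: card_partitions_upto_eq_partition_number)
  have "(?P * ?E) $ n = (?R * ?F) $ n"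
    unfolding fps_mult_nth by (intro sum.cong refl arg_cong2[where f = times] E P) simp_all
  then show "(?P * ?E) $ n = 1 $ n" by (simp only: partitions_upto_gf)
qed

theorem theorem1:
  fixes n :: nat
  shows "real (partition_number n) =
           1 / fact n * (\<Sum>k=0..n. (-1) ^ k * fact k * partial_bell n k pent_lambda)"
proof -
  define g where "g = Abs_fps (\<lambda>m. if m = 0 then 0 else pent_lambda m / fact m)"
  define P where "P = Abs_fps (\<lambda>n. real (partition_number n))"
  define S where "S = (\<Sum>k=0..n. (- g) ^ k)"
  have "(1 + g) * S = 1 - (- g) ^ Suc n"
    unfolding S_def using sum_gp_basic[of "- g" n] by (simp add: atLeast0AtMost)
  moreover have "P * (1 + g) = 1"
    unfolding P_def g_def by (rule partition_number_gf_mult_pentagonal)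
  ultimately have "S = P - P * (- g) ^ Suc n"
    by (metis mult.assoc mult_1 mult_1_right right_diff_distrib)
  \<comment> \<open>As \<open>g\<close> has no constant term, the error of the truncated geometric series starts in degree \<open>n + 1\<close>.\<close>
  moreover have "(P * (- g) ^ Suc n) $ n = 0"
    unfolding fps_mult_nth
    by (intro sum.neutral) (auto simp: g_def startsby_zero_power_prefix simp del: power_Suc)
  ultimately have "real (partition_number n) = S $ n" by (simp add: P_def)
  also have "\<dots> = (\<Sum>k=0..n. (-1) ^ k * (g ^ k) $ n)"
  proof -
    have "((- g) ^ k) $ n = (-1) ^ k * (g ^ k) $ n" for k
      by (cases "even k") auto
    then show ?thesis by (simp add: S_def fps_sum_nth)
  qed
  also have "\<dots> = 1 / fact n * (\<Sum>k=0..n. (-1) ^ k * (fact k * partial_bell n k pent_lambda))"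
    unfolding partial_bell_eq_fps_power_nth g_def by (simp add: sum_distrib_left)
  finally show ?thesis by (simp add: mult.assoc)
qed

end
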